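(* Let $k\ge 3$ be an integer and let two nested circles in the plane (the parent circles) be given that admit a Steiner chain of length $k$. Then for every $m=1,2,\ldots,k-1$ the sum $$I_m=\sum_{j=1}^k b_j^m,$$ where $b_1,\ldots,b_k$ are the curvatures of the circles of a Steiner chain of length $k$ with the given parent circles, is the same for all Steiner chains of length $k$ with these parent circles; that is, $I_m$ remains constant in the 1-parameter family of Steiner chains of length $k$ having the given parent circles.
   Context: Two circles in the Euclidean plane are nested if one of them (the inner circle) lies in the open disk bounded by the other (the outer circle). Given two nested circles (called the parent circles), a Steiner chain of length $k$ is a cyclically ordered collection of $k$ pairwise distinct circles $c_1,\ldots,c_k$ inscribed in the annulus bounded by the parent circles, i.e. each $c_j$ is externally tangent to the inner parent circle and internally tangent to the outer parent circle, such that $c_j$ and $c_{j+1}$ are externally tangent for each $j$, with indices taken modulo $k$ (the chain closes up after $k$ steps). The chain is allowed to make several turns around the annulus, so non-consecutive circles may overlap. The curvature of a circle of radius $r$ in a Steiner chain is $b=1/r$. By the Steiner porism, if one Steiner chain of length $k$ exists for a pair of parent circles, then a Steiner chain of length $k$ exists starting from any circle inscribed in the annulus; these chains form a 1-parameter family. *)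

theory Defs
  imports "HOL-Analysis.Analysis"
begin

text \<open>A circle in the plane is given by its center and radius. Values whose radius is not
  positive are excluded by \<open>is_circle\<close>; on the remaining ones equality of circles coincides
  with equality of the underlying point sets.\<close>

datatype circle = Circle (center: "real^2") (radius: real)

definition is_circle :: "circle \<Rightarrow> bool" where
  "is_circle c \<longleftrightarrow> radius c > 0"

definition circle_points :: "circle \<Rightarrow> (real^2) set" where
  "circle_points c = sphere (center c) (radius c)"

definition open_disk :: "circle \<Rightarrow> (real^2) set" where
  "open_disk c = ball (center c) (radius c)"

definition curvature :: "circle \<Rightarrow> real" where
  "curvature c = 1 / radius c"

definition nested :: "circle \<Rightarrow> circle \<Rightarrow> bool" where
  "nested P Q \<longleftrightarrow> is_circle P \<and> is_circle Q \<and> circle_points P \<subseteq> open_disk Q"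

definition externally_tangent :: "circle \<Rightarrow> circle \<Rightarrow> bool" where
  "externally_tangent c d \<longleftrightarrow> dist (center c) (center d) = radius c + radius d"

text \<open>In \<open>internally_tangent c d\<close> the circle \<open>c\<close> is the one inside; the strict inequality
  excludes \<open>c = d\<close>.\<close>

definition internally_tangent :: "circle \<Rightarrow> circle \<Rightarrow> bool" where
  "internally_tangent c d \<longleftrightarrow>
     radius c < radius d \<and> dist (center c) (center d) = radius d - radius c"

definition inscribed_in_annulus :: "circle \<Rightarrow> circle \<Rightarrow> circle \<Rightarrow> bool" where
  "inscribed_in_annulus P Q c \<longleftrightarrow>
     is_circle c \<and> externally_tangent c P \<and> internally_tangent c Q"

text \<open>The chain is indexed by \<open>0, \<dots>, k - 1\<close> modulo \<open>k\<close>; values \<open>c j\<close> with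
  \<open>j \<ge> k\<close> play no role. Non-consecutive circles may overlap, so the chain may wind around
  the annulus several times.\<close>

definition steiner_chain :: "circle \<Rightarrow> circle \<Rightarrow> nat \<Rightarrow> (nat \<Rightarrow> circle) \<Rightarrow> bool" where
  "steiner_chain P Q k c \<longleftrightarrow>
     inj_on c {..<k} \<and>
     (\<forall>j<k. inscribed_in_annulus P Q (c j)) \<and>
     (\<forall>j<k. externally_tangent (c j) (c (Suc j mod k)))"

end

theory Submission
  imports Defs
begin

text \<open>The curvatures of a chain turn out to be the first coordinates of the vertices of a regular
  (possibly star-shaped) \<open>k\<close>-gon on a circle, up to an affine map that depends on the parent
  circles only. A polynomial in one coordinate of degree less than \<open>k\<close> has the same sum over the
  vertices of every such polygon, because all Fourier modes between \<open>1\<close> and \<open>k - 1\<close> cancel.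

  Concretely, put the origin at the centre of the inner circle \<open>P\<close>, of radius \<open>r\<close>, and the first
  axis through the centre of the outer circle \<open>Q\<close>. A circle with centre \<open>(x, y)\<close> and
  curvature \<open>b\<close> gets the coordinates \<open>u = b x\<close> and \<open>v = b y\<close> besides \<open>b\<close> itself. Tangency
  to \<open>P\<close> becomes \<open>u\<^sup>2 + v\<^sup>2 = (1 + r b)\<^sup>2\<close> (\<open>inscribed_quadric\<close>), and
  tangency to \<open>Q\<close> then becomes a linear equation that expresses \<open>u\<close> affinely through \<open>b\<close>
  (\<open>axial_affine_in_curvature\<close>). So the inscribed circles are points \<open>(b, v)\<close> of a conic, which
  is an ellipse because the parent circles are nested. Tangency of two inscribed circles fixes the
  value of the polarised quadratic form (\<open>tangent_quadric_product\<close>). After the ellipse is rescaled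
  to the unit circle, this says that consecutive points \<open>w\<close> of the chain differ by a fixed angle,
  up to sign. Because the circles of the chain are distinct, the sign cannot change along the chain,
  so that \<open>w\<close> runs through \<open>w\<^sub>0 t\<^sup>j\<close> for a primitive \<open>k\<close>-th root of unity \<open>t\<close>
  (\<open>cyclic_equal_steps_geometric\<close>). Since \<open>b = A + B Re w\<close>, where \<open>A\<close> and \<open>B\<close> come from the
  parent circles, \<open>sum_trig_power_over_regular_polygon\<close> gives a value of the power sum in which neither
  \<open>w\<^sub>0\<close> nor \<open>t\<close> occurs.

  For concentric parents the axis is undefined, but then all inscribed circles have the same radius.\<close>

section \<open>Power sums over a regular polygon\<close>

lemma sum_powers_root_of_unity_eq_0:
  fixes t :: "'a :: field"
  assumes "t ^ k = 1" and "t ^ n \<noteq> 1"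
  shows "(\<Sum>j<k. (t ^ j) ^ n) = 0"
proof -
  have "(\<Sum>j<k. (t ^ j) ^ n) = (\<Sum>j<k. (t ^ n) ^ j)"
    by (simp add: mult.commute flip: power_mult)
  also have "\<dots> = ((t ^ n) ^ k - 1) / (t ^ n - 1)"
    using assms(2) by (rule geometric_sum)
  also have "(t ^ n) ^ k = (t ^ k) ^ n"
    by (simp add: mult.commute flip: power_mult)
  finally show ?thesis
    using assms(1) by simp
qed

text \<open>On the unit circle \<open>Re z = (z + 1/z) / 2\<close>, so \<open>(A + B Re z)\<^sup>m\<close> is a Laurent polynomial with
  exponents between \<open>-m\<close> and \<open>m\<close>. As \<open>m < k\<close>, only its constant term survives the summation over
  the polygon. That term is the middle coefficient of the polynomial that results from the
  multiplication by \<open>z\<^sup>m\<close>.\<close>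

lemma sum_trig_power_over_regular_polygon:
  fixes w t :: complex and A B :: real
  assumes "norm w = 1" and "norm t = 1" and "t ^ k = 1"
    and prim: "\<And>n. 0 < n \<Longrightarrow> n < k \<Longrightarrow> t ^ n \<noteq> 1"
    and "m < k"
  shows "(\<Sum>j<k. (A + B * Re (w * t ^ j)) ^ m)
       = k * Re (coeff ([:of_real (B / 2), of_real A, of_real (B / 2):] ^ m) m)"
proof -
  define p :: "complex poly" where "p = [:of_real (B / 2), of_real A, of_real (B / 2):] ^ m"
  have "degree p \<le> degree [:complex_of_real (B / 2), of_real A, of_real (B / 2):] * m"
    unfolding p_def by (rule degree_power_le)
  also have "\<dots> \<le> 2 * m"
    by (intro mult_right_mono) auto
  finally have deg: "degree p \<le> 2 * m" .
  define z where "z = (\<lambda>j. w * t ^ j)"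
  have z_cnj: "z j * cnj (z j) = 1" for j
  proof -
    have "norm (z j) = 1"
      using assms(1,2) by (simp add: z_def norm_mult norm_power)
    then show ?thesis
      by (simp flip: complex_norm_square)
  qed
  have expand: "of_real ((A + B * Re (z j)) ^ m)
      = (\<Sum>i\<le>2 * m. coeff p i * (z j ^ i * cnj (z j) ^ m))" for j
  proof -
    have "of_real (A + B * Re (z j)) = of_real A + of_real (B / 2) * (z j + cnj (z j))"
      by (simp add: complex_add_cnj)
    also have "\<dots> = cnj (z j) * (of_real (B / 2) + z j * of_real A + (z j)\<^sup>2 * of_real (B / 2))"
    proof -
      have "cnj (z j) * (of_real (B / 2) + z j * of_real A + (z j)\<^sup>2 * of_real (B / 2))
          = cnj (z j) * of_real (B / 2) + (z j * cnj (z j)) * of_real A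
            + z j * (z j * cnj (z j)) * of_real (B / 2)"
        by (simp only: power2_eq_square distrib_left mult_ac)
      also have "\<dots> = cnj (z j) * of_real (B / 2) + of_real A + z j * of_real (B / 2)"
        by (simp only: z_cnj mult_1_left mult_1_right)
      also have "\<dots> = of_real A + of_real (B / 2) * (z j + cnj (z j))"
        by (simp only: distrib_left distrib_right ac_simps)
      finally show ?thesis
        by (rule sym)
    qed
    finally have base: "of_real (A + B * Re (z j))
        = cnj (z j) * (of_real (B / 2) + z j * of_real A + (z j)\<^sup>2 * of_real (B / 2))" .
    have "poly p (z j) = (of_real (B / 2) + z j * of_real A + (z j)\<^sup>2 * of_real (B / 2)) ^ m"
      by (simp add: p_def poly_power power2_eq_square algebra_simps)
    then have "of_real ((A + B * Re (z j)) ^ m) = cnj (z j) ^ m * poly p (z j)"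
      by (simp only: of_real_power base power_mult_distrib)
    also have "poly p (z j) = (\<Sum>i\<le>2 * m. coeff p i * z j ^ i)"
      unfolding poly_altdef using deg by (intro sum.mono_neutral_left) (auto intro: coeff_eq_0)
    finally show ?thesis
      by (simp add: sum_distrib_left mult_ac)
  qed
  have power_sum: "(\<Sum>j<k. z j ^ i * cnj (z j) ^ m) = (if i = m then of_nat k else 0)"
    if "i \<le> 2 * m" for i
  proof (cases i m rule: linorder_cases)
    case less
    have "z j ^ i * cnj (z j) ^ m = cnj (w ^ (m - i) * (t ^ j) ^ (m - i))" for j
    proof -
      have "z j ^ i * cnj (z j) ^ m = (z j * cnj (z j)) ^ i * cnj (z j) ^ (m - i)"
        using less by (simp add: power_mult_distrib flip: power_add)
      then show ?thesis
        unfolding z_cnj by (simp add: z_def power_mult_distrib)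
    qed
    then have "(\<Sum>j<k. z j ^ i * cnj (z j) ^ m) = cnj (w ^ (m - i) * (\<Sum>j<k. (t ^ j) ^ (m - i)))"
      by (simp add: sum_distrib_left)
    also have "(\<Sum>j<k. (t ^ j) ^ (m - i)) = 0"
      using assms less by (intro sum_powers_root_of_unity_eq_0 prim) auto
    finally show ?thesis
      using less by simp
  next
    case equal
    then show ?thesis
      using z_cnj by (simp flip: power_mult_distrib)
  next
    case greater
    have "z j ^ i * cnj (z j) ^ m = w ^ (i - m) * (t ^ j) ^ (i - m)" for j
    proof -
      have "z j ^ i * cnj (z j) ^ m = (z j * cnj (z j)) ^ m * z j ^ (i - m)"
        using greater by (simp add: power_mult_distrib mult_ac flip: power_add)
      then show ?thesis
        unfolding z_cnj by (simp add: z_def power_mult_distrib)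
    qed
    then have "(\<Sum>j<k. z j ^ i * cnj (z j) ^ m) = w ^ (i - m) * (\<Sum>j<k. (t ^ j) ^ (i - m))"
      by (simp add: sum_distrib_left)
    also have "(\<Sum>j<k. (t ^ j) ^ (i - m)) = 0"
      using assms greater that by (intro sum_powers_root_of_unity_eq_0 prim) auto
    finally show ?thesis
      using greater by simp
  qed
  have "of_real (\<Sum>j<k. (A + B * Re (z j)) ^ m)
      = (\<Sum>i\<le>2 * m. coeff p i * (\<Sum>j<k. z j ^ i * cnj (z j) ^ m))"
    unfolding of_real_sum expand sum_distrib_left by (rule sum.swap)
  also have "\<dots> = (\<Sum>i\<le>2 * m. if i = m then of_nat k * coeff p m else 0)"
    by (intro sum.cong refl) (simp add: power_sum)
  also have "\<dots> = of_nat k * coeff p m"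
    by simp
  finally have "Re (of_real (\<Sum>j<k. (A + B * Re (z j)) ^ m)) = Re (of_nat k * coeff p m)"
    by (rule arg_cong)
  then show ?thesis
    by (simp add: z_def p_def)
qed

section \<open>Closed chains of points on the unit circle\<close>

lemma unit_complex_eq_or_cnj:
  fixes s t :: complex
  assumes "norm s = norm t" and "Re s = Re t"
  shows "s = t \<or> s = cnj t"
proof -
  have "(Im s)\<^sup>2 = (Im t)\<^sup>2"
    using assms cmod_power2[of s] cmod_power2[of t] by simp
  then show ?thesis
    using assms(2) by (auto simp: complex_eq_iff power2_eq_iff)
qed

text \<open>A rotation is determined by its cosine up to inversion, and after a step from \<open>a\<close> to \<open>b\<close>
  the inverse rotation would lead back to \<open>a\<close>.\<close>

lemma equal_steps_without_backtracking:
  fixes a b c :: complex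
  assumes "norm a = 1" "norm b = 1" "norm c = 1"
    and "Re (b * cnj a) = Re (c * cnj b)" and "a \<noteq> c"
  shows "c * cnj b = b * cnj a"
proof -
  have "b * cnj a \<noteq> cnj (c * cnj b)"
    using assms by auto
  moreover have "norm (b * cnj a) = norm (c * cnj b)"
    using assms by (simp add: norm_mult)
  ultimately show ?thesis
    using unit_complex_eq_or_cnj assms(4) by metis
qed

text \<open>At least three distinct points are needed for the chain never to return to the point before
  last; hence it keeps turning in the same direction. Injectivity of \<open>w\<close> makes the rotation \<open>t\<close> a
  primitive root of unity, so the number of turns is coprime to \<open>k\<close>.\<close>

lemma cyclic_equal_steps_geometric:
  fixes w :: "nat \<Rightarrow> complex"
  assumes "k \<ge> 3"
    and inj: "inj_on w {..<k}"
    and unit: "\<And>j. j < k \<Longrightarrow> norm (w j) = 1"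
    and step: "\<And>j. j < k \<Longrightarrow> Re (w (Suc j mod k) * cnj (w j)) = \<kappa>"
  obtains t where "norm t = 1" and "t ^ k = 1"
    and "\<And>n. 0 < n \<Longrightarrow> n < k \<Longrightarrow> t ^ n \<noteq> 1"
    and "\<And>j. j < k \<Longrightarrow> w j = w 0 * t ^ j"
proof -
  \<comment> \<open>Extended periodically, the chain passes the seam at \<open>k\<close> like any other place.\<close>
  define f where "f j = w (j mod k)" for j
  define t where "t = f 1 * cnj (f 0)"
  have f_unit: "norm (f j) = 1" for j
    using assms(1) by (auto simp: f_def intro!: unit)
  have f_step: "Re (f (Suc j) * cnj (f j)) = \<kappa>" for j
    using step[of "j mod k"] assms(1) by (simp add: f_def mod_Suc_eq)
  have no_return: "f j \<noteq> f (Suc (Suc j))" for j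
  proof
    assume "f j = f (Suc (Suc j))"
    then have "(j + 0) mod k = (j + 2) mod k"
      using inj assms(1) by (auto simp: f_def dest!: inj_onD)
    then have "k dvd 2"
      by (metis add_diff_cancel_left' add.right_neutral le_add1 mod_eq_dvd_iff_nat)
    then show False
      using assms(1) by (auto dest: dvd_imp_le)
  qed
  have quotient: "f (Suc j) * cnj (f j) = t" for j
  proof (induction j)
    case (Suc j)
    have "f (Suc (Suc j)) * cnj (f (Suc j)) = f (Suc j) * cnj (f j)"
      using f_step[of j] f_step[of "Suc j"]
      by (intro equal_steps_without_backtracking f_unit no_return) simp
    then show ?case
      using Suc by simp
  qed (simp add: t_def)
  have successor: "f (Suc j) = f j * t" for j
  proof -
    have "f (Suc j) = f (Suc j) * (f j * cnj (f j))"
      using f_unit[of j] by (simp flip: complex_norm_square)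
    then show ?thesis
      unfolding quotient[of j, symmetric] by (simp add: mult_ac)
  qed
  have geometric: "f j = f 0 * t ^ j" for j
    by (induction j) (simp_all add: successor)
  have "f 0 \<noteq> 0"
    using f_unit[of 0] by auto
  show ?thesis
  proof (rule that)
    show "norm t = 1"
      by (simp add: t_def norm_mult f_unit)
    show "t ^ k = 1"
      using geometric[of k] \<open>f 0 \<noteq> 0\<close> by (simp add: f_def)
    show w_geometric: "w j = w 0 * t ^ j" if "j < k" for j
      using geometric[of j] that by (simp add: f_def)
    show "t ^ n \<noteq> 1" if "0 < n" "n < k" for n
      using w_geometric[of n] that inj_onD[OF inj, of n 0] by auto
  qed
qed

text \<open>The equations say that the points \<open>(b j, v j)\<close> lie on the conic \<open>v\<^sup>2 = q b\<close>, with \<open>q\<close>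
  a quadratic polynomial, and that the polarised form of the conic takes the value \<open>\<tau>\<close> at
  consecutive points. As \<open>\<alpha> < 0\<close> and \<open>\<tau> \<noteq> 0\<close>, a
  conic that contains such points is a proper ellipse, with centre \<open>(A, 0)\<close> and semi-axes
  \<open>B\<close> and \<open>C\<close>, and points of it with parameters \<open>\<phi>\<close> and \<open>\<psi>\<close> have polarised value
  \<open>C\<^sup>2 (1 - cos (\<phi> - \<psi>))\<close>: the second condition fixes the angle between neighbours.\<close>

lemma power_sum_of_conic_chain_constant:
  fixes \<alpha> \<beta> \<gamma> \<tau> :: real
  assumes "k \<ge> 3" and "m < k" and "\<alpha> < 0" and "\<tau> \<noteq> 0"
  shows "\<exists>I. \<forall>b v :: nat \<Rightarrow> real.
    inj_on (\<lambda>j. (b j, v j)) {..<k} \<longrightarrow>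
    (\<forall>j<k. (v j)\<^sup>2 = \<alpha> * (b j)\<^sup>2 + 2 * \<beta> * b j + \<gamma>) \<longrightarrow>
    (\<forall>j<k. \<alpha> * b j * b (Suc j mod k) + \<beta> * (b j + b (Suc j mod k)) + \<gamma>
             - v j * v (Suc j mod k) = \<tau>) \<longrightarrow>
    (\<Sum>j<k. b j ^ m) = I"
proof -
  define A where "A = - \<beta> / \<alpha>"
  define D where "D = \<gamma> - \<beta>\<^sup>2 / \<alpha>"
  define C where "C = sqrt D"
  define B where "B = sqrt (D / - \<alpha>)"
  have polar: "\<alpha> * x * y + \<beta> * (x + y) + \<gamma> = \<alpha> * (x - A) * (y - A) + D" for x y
    using assms(3) by (simp add: A_def D_def field_simps power2_eq_square)
  show ?thesis
  proof (intro exI allI impI)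
    fix b v :: "nat \<Rightarrow> real"
    assume inj: "inj_on (\<lambda>j. (b j, v j)) {..<k}"
      and conic: "\<forall>j<k. (v j)\<^sup>2 = \<alpha> * (b j)\<^sup>2 + 2 * \<beta> * b j + \<gamma>"
      and tang: "\<forall>j<k. \<alpha> * b j * b (Suc j mod k) + \<beta> * (b j + b (Suc j mod k)) + \<gamma>
             - v j * v (Suc j mod k) = \<tau>"
    have conic': "(v j)\<^sup>2 - \<alpha> * (b j - A)\<^sup>2 = D" if "j < k" for j
      using conic that polar[of "b j" "b j"] by (simp add: power2_eq_square algebra_simps)
    have tang': "\<alpha> * (b j - A) * (b (Suc j mod k) - A) + D - v j * v (Suc j mod k) = \<tau>"
      if "j < k" for j
      using tang[rule_format, OF that] polar[of "b j" "b (Suc j mod k)"] by linarith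
    have nonneg: "0 \<le> - \<alpha> * (b j - A)\<^sup>2" for j
      using assms(3) by (intro mult_nonneg_nonneg) auto
    \<comment> \<open>A degenerate ellipse is a single point, where the polarised form vanishes, but
      \<open>\<tau> \<noteq> 0\<close>.\<close>
    have "D \<noteq> 0"
    proof
      assume "D = 0"
      have "v j = 0 \<and> b j = A" if "j < k" for j
      proof -
        have "(v j)\<^sup>2 = 0" "- \<alpha> * (b j - A)\<^sup>2 = 0"
          using conic'[OF that] nonneg[of j] zero_le_power2[of "v j"] \<open>D = 0\<close> by linarith+
        then show ?thesis
          using assms(3) by simp
      qed
      from this[of 0] show False
        using tang'[of 0] assms(1,4) \<open>D = 0\<close> by simp
    qed
    moreover have "0 \<le> D"
      using conic'[of 0] nonneg[of 0] zero_le_power2[of "v 0"] assms(1) by linarith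
    ultimately have "D > 0"
      by simp
    moreover from this have "D / - \<alpha> > 0"
      using assms(3) by (intro divide_pos_pos) auto
    ultimately have BC: "B > 0" "C > 0" "B\<^sup>2 = D / - \<alpha>" "C\<^sup>2 = D"
      unfolding B_def C_def by (simp_all only: real_sqrt_gt_zero real_sqrt_pow2 less_imp_le)
    define w where "w j = Complex ((b j - A) / B) (v j / C)" for j
    have cos_sin: "((x - A) / B) * ((y - A) / B) + (z / C) * (u / C)
        = (- \<alpha> * (x - A) * (y - A) + z * u) / D" for x y z u
    proof -
      have "((x - A) / B) * ((y - A) / B) + (z / C) * (u / C)
          = (x - A) * (y - A) / B\<^sup>2 + z * u / C\<^sup>2"
        by (simp only: power2_eq_square times_divide_times_eq)
      then show ?thesis
        unfolding BC(3,4) by (simp only: divide_divide_eq_right add_divide_distrib ac_simps)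
    qed
    have unit: "norm (w j) = 1" if "j < k" for j
    proof -
      have "- \<alpha> * (b j - A) * (b j - A) + v j * v j = D"
        using conic'[OF that] by (simp add: power2_eq_square)
      moreover have "(norm (w j))\<^sup>2
          = ((b j - A) / B) * ((b j - A) / B) + (v j / C) * (v j / C)"
        by (simp only: cmod_power2) (simp only: power2_eq_square w_def complex.sel)
      ultimately have "(norm (w j))\<^sup>2 = D / D"
        by (simp only: cos_sin)
      then have "(norm (w j))\<^sup>2 = 1"
        using \<open>D > 0\<close> by simp
      then show ?thesis
        by (simp add: power2_eq_1_iff) (use norm_ge_zero[of "w j"] in linarith)
    qed
    have step: "Re (w (Suc j mod k) * cnj (w j)) = 1 - \<tau> / D" if "j < k" for j
    proof -
      define i where "i = Suc j mod k"
      have "- \<alpha> * (b i - A) * (b j - A) + v i * v j = D - \<tau>"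
        using tang'[OF that] by (simp add: i_def mult_ac)
      moreover have "Re (w i * cnj (w j)) = ((b i - A) / B) * ((b j - A) / B) + (v i / C) * (v j / C)"
        by (simp add: w_def)
      ultimately have "Re (w i * cnj (w j)) = (D - \<tau>) / D"
        by (simp only: cos_sin)
      then show ?thesis
        using \<open>D > 0\<close> by (simp add: i_def diff_divide_distrib)
    qed
    have inj_w: "inj_on w {..<k}"
      using inj BC(1,2) by (auto simp: inj_on_def w_def)
    obtain t where t: "norm t = 1" "t ^ k = 1"
        "\<And>n. 0 < n \<Longrightarrow> n < k \<Longrightarrow> t ^ n \<noteq> 1" "\<And>j. j < k \<Longrightarrow> w j = w 0 * t ^ j"
      using cyclic_equal_steps_geometric[OF assms(1) inj_w unit step] by blast
    have "norm (w 0) = 1"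
      using unit assms(1) by simp
    have "(\<Sum>j<k. b j ^ m) = (\<Sum>j<k. (A + B * Re (w 0 * t ^ j)) ^ m)"
    proof (intro sum.cong refl)
      fix j assume "j \<in> {..<k}"
      have "b j = A + B * Re (w j)"
        using BC(1) by (simp add: w_def)
      then show "b j ^ m = (A + B * Re (w 0 * t ^ j)) ^ m"
        using t(4)[of j] \<open>j \<in> {..<k}\<close> by simp
    qed
    also have "\<dots> = k * Re (coeff ([:of_real (B / 2), of_real A, of_real (B / 2):] ^ m) m)"
      using sum_trig_power_over_regular_polygon[OF \<open>norm (w 0) = 1\<close> t(1-3) assms(2)] by blast
    finally show "(\<Sum>j<k. b j ^ m)
        = k * Re (coeff ([:of_real (B / 2), of_real A, of_real (B / 2):] ^ m) m)" .
  qed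
qed

section \<open>Coordinates for circles inscribed in the annulus\<close>

lemma inner_real_2: "(x :: real^2) \<bullet> y = x $ 1 * y $ 1 + x $ 2 * y $ 2"
  by (simp add: inner_vec_def sum_2)

text \<open>The point of the inner circle that is farthest from the centre of the outer one is decisive.\<close>

lemma nested_dist_centers:
  assumes "nested P Q"
  shows "dist (center P) (center Q) + radius P < radius Q"
proof (cases "center P = center Q")
  case True
  obtain x where "x \<in> circle_points P"
    using assms vector_choose_dist[of "radius P" "center P"]
    by (auto simp: nested_def is_circle_def circle_points_def)
  then show ?thesis
    using assms True by (auto simp: nested_def circle_points_def open_disk_def dist_commute subset_iff)
next
  case False
  define d where "d = dist (center P) (center Q)"
  have "d > 0"
    using False by (simp add: d_def)
  \<comment> \<open>The point of \<open>P\<close> opposite to the centre of \<open>Q\<close>.\<close>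
  define x where "x = center P + (radius P / d) *\<^sub>R (center P - center Q)"
  have nd: "norm (center P - center Q) = d"
    by (simp add: d_def dist_norm)
  have r: "radius P > 0"
    using assms by (simp add: nested_def is_circle_def)
  have "dist (center P) x = radius P"
    using r \<open>d > 0\<close> by (simp add: x_def dist_norm nd)
  then have "x \<in> open_disk Q"
    using assms by (auto simp: nested_def circle_points_def)
  moreover have "x - center Q = (1 + radius P / d) *\<^sub>R (center P - center Q)"
    by (simp add: x_def algebra_simps)
  then have "norm (x - center Q) = \<bar>1 + radius P / d\<bar> * d"
    by (simp only: norm_scaleR nd)
  then have "norm (x - center Q) = d + radius P"
    using r \<open>d > 0\<close> by (simp add: distrib_right abs_of_pos add_pos_pos)
  then have "dist (center Q) x = d + radius P"
    by (simp add: dist_norm norm_minus_commute)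
  ultimately show ?thesis
    by (simp add: open_disk_def d_def)
qed

text \<open>The coordinates of the centre of \<open>c\<close>, scaled by its curvature, in the orthogonal frame at the
  centre of \<open>P\<close> whose first axis points to the centre of \<open>Q\<close>. The scaling is what makes the
  tangency conditions polynomial in the curvature.\<close>

definition axial :: "circle \<Rightarrow> circle \<Rightarrow> circle \<Rightarrow> real" where
  "axial P Q c = ((center c - center P) \<bullet> (center Q - center P))
     / (dist (center P) (center Q) * radius c)"

definition transversal :: "circle \<Rightarrow> circle \<Rightarrow> circle \<Rightarrow> real" where
  "transversal P Q c =
     ((center c - center P) $ 1 * (center Q - center P) $ 2
      - (center c - center P) $ 2 * (center Q - center P) $ 1)
     / (dist (center P) (center Q) * radius c)"

lemma axial_transversal_inner:
  assumes "center P \<noteq> center Q"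
  shows "axial P Q c * axial P Q c' + transversal P Q c * transversal P Q c'
       = ((center c - center P) \<bullet> (center c' - center P)) / (radius c * radius c')"
proof -
  define x y D where "x = center c - center P" and "y = center c' - center P"
    and "D = center Q - center P"
  have "(x \<bullet> D) * (y \<bullet> D) + (x $ 1 * D $ 2 - x $ 2 * D $ 1) * (y $ 1 * D $ 2 - y $ 2 * D $ 1)
      = (x \<bullet> y) * (D \<bullet> D)"
    unfolding inner_real_2 by (simp add: algebra_simps)
  also have "D \<bullet> D = (dist (center P) (center Q))\<^sup>2"
    by (simp add: D_def dist_norm norm_minus_commute flip: power2_norm_eq_inner)
  finally have "((x \<bullet> D) * (y \<bullet> D) + (x $ 1 * D $ 2 - x $ 2 * D $ 1) * (y $ 1 * D $ 2 - y $ 2 * D $ 1))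
      / ((dist (center P) (center Q))\<^sup>2 * (radius c * radius c'))
      = (x \<bullet> y) / (radius c * radius c')"
    using assms by simp
  then show ?thesis
    unfolding axial_def transversal_def x_def[symmetric] y_def[symmetric] D_def[symmetric]
    by (simp add: add_divide_distrib power2_eq_square mult_ac)
qed

lemma inscribed_norm:
  assumes "inscribed_in_annulus P Q c"
  shows "radius c > 0" "norm (center c - center P) = radius c + radius P"
    "norm (center c - center Q) = radius Q - radius c"
  using assms by (auto simp: inscribed_in_annulus_def is_circle_def externally_tangent_def
      internally_tangent_def dist_norm)

text \<open>The difference of the squared tangency conditions with \<open>P\<close> and with \<open>Q\<close>: both the
  square of the centre and the square of the radius of \<open>c\<close> drop out.\<close>

lemma inscribed_power:
  assumes "inscribed_in_annulus P Q c"
  shows "2 * ((center c - center P) \<bullet> (center Q - center P))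
    = 2 * (radius P + radius Q) * radius c
      - ((radius Q)\<^sup>2 - (radius P)\<^sup>2 - (dist (center P) (center Q))\<^sup>2)"
proof -
  define x D where "x = center c - center P" and "D = center Q - center P"
  have "(norm (x - D))\<^sup>2 = (norm x)\<^sup>2 - 2 * (x \<bullet> D) + (norm D)\<^sup>2"
    by (simp add: power2_norm_eq_inner inner_diff inner_commute)
  moreover have "norm (x - D) = radius Q - radius c" "norm x = radius c + radius P"
    "norm D = dist (center P) (center Q)"
    using inscribed_norm[OF assms] by (simp_all add: x_def D_def dist_norm norm_minus_commute)
  ultimately show ?thesis
    unfolding x_def[symmetric] D_def[symmetric] by (simp add: power2_eq_square algebra_simps)
qed

lemma axial_affine_in_curvature:
  assumes "inscribed_in_annulus P Q c" and "center P \<noteq> center Q"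
  defines "d \<equiv> dist (center P) (center Q)"
  shows "axial P Q c = (radius P + radius Q) / d
    - ((radius Q)\<^sup>2 - (radius P)\<^sup>2 - d\<^sup>2) / (2 * d) * curvature c"
proof -
  have "d > 0"
    using assms(2) by (simp add: d_def)
  have "axial P Q c
      = (2 * ((center c - center P) \<bullet> (center Q - center P))) / (2 * (d * radius c))"
    by (simp add: axial_def d_def)
  also have "\<dots> = (radius P + radius Q) / d
    - ((radius Q)\<^sup>2 - (radius P)\<^sup>2 - d\<^sup>2) / (2 * d) * curvature c"
    unfolding inscribed_power[OF assms(1)] d_def[symmetric]
    using \<open>d > 0\<close> inscribed_norm(1)[OF assms(1)]
    by (simp add: curvature_def diff_divide_eq_iff add_divide_eq_iff divide_simps)
  finally show ?thesis .
qed

lemma inscribed_quadric: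
  assumes "inscribed_in_annulus P Q c" and "center P \<noteq> center Q"
  shows "(axial P Q c)\<^sup>2 + (transversal P Q c)\<^sup>2 = (1 + radius P * curvature c)\<^sup>2"
  using axial_transversal_inner[OF assms(2), of c c] inscribed_norm[OF assms(1)]
  by (simp add: curvature_def field_simps flip: power2_eq_square power2_norm_eq_inner)

text \<open>The squared tangency condition \<open>|x - y|\<^sup>2 = (\<rho> + \<rho>')\<^sup>2\<close>, in which \<open>|x| = \<rho> + r\<close> and
  \<open>|y| = \<rho>' + r\<close> turn the inner product into a polynomial in the radii. The left-hand side is the
  polarisation of the quadratic form that vanishes in \<open>inscribed_quadric\<close>.\<close>

lemma tangent_quadric_product:
  assumes "inscribed_in_annulus P Q c" and "inscribed_in_annulus P Q c'"
    and "externally_tangent c c'" and "center P \<noteq> center Q"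
  shows "(1 + radius P * curvature c) * (1 + radius P * curvature c')
    - axial P Q c * axial P Q c' - transversal P Q c * transversal P Q c' = 2"
proof -
  define x y where "x = center c - center P" and "y = center c' - center P"
  note c = inscribed_norm[OF assms(1)] and c' = inscribed_norm[OF assms(2)]
  have "(norm (x - y))\<^sup>2 = (norm x)\<^sup>2 - 2 * (x \<bullet> y) + (norm y)\<^sup>2"
    by (simp add: power2_norm_eq_inner inner_diff inner_commute)
  moreover have "norm (x - y) = radius c + radius c'"
    using assms(3) by (simp add: x_def y_def externally_tangent_def dist_norm)
  ultimately have "x \<bullet> y = radius P * (radius c + radius c') + (radius P)\<^sup>2 - radius c * radius c'"
    using c(2) c'(2) unfolding x_def[symmetric] y_def[symmetric]
    by (simp add: power2_eq_square algebra_simps)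
  then show ?thesis
    using axial_transversal_inner[OF assms(4), of c c'] c(1) c'(1)
    unfolding x_def[symmetric] y_def[symmetric]
    by (simp add: curvature_def field_simps power2_eq_square)
qed

text \<open>The projection to the \<open>(b, v)\<close>-plane of the conic loses nothing, so distinct circles of a
  chain remain distinct points.\<close>

lemma inscribed_eqI:
  assumes "inscribed_in_annulus P Q c" and "inscribed_in_annulus P Q c'"
    and "center P \<noteq> center Q"
    and "curvature c = curvature c'" and "transversal P Q c = transversal P Q c'"
  shows "c = c'"
proof -
  have rad: "radius c = radius c'"
    using assms(4) by (simp add: curvature_def)
  \<comment> \<open>An auxiliary circle whose coordinates measure the difference of the two centres.\<close>
  define e where "e = circle.Circle (center c - center c' + center P) 1"
  have "axial P Q c = axial P Q c'"
    using axial_affine_in_curvature assms by metis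
  then have "axial P Q e = 0" "transversal P Q e = 0"
    using assms(3,5) rad inscribed_norm(1)[OF assms(1)] inscribed_norm(1)[OF assms(2)]
    by (simp_all add: axial_def transversal_def e_def inner_diff field_simps)
  then have "center c = center c'"
    using axial_transversal_inner[OF assms(3), of e e] by (simp add: e_def)
  then show ?thesis
    using rad by (simp add: circle.expand)
qed

section \<open>Constancy of the power sums of curvatures\<close>

theorem theorem1:
  fixes P Q :: circle and k :: nat
  assumes "k \<ge> 3"
    and "nested P Q"
    and "\<exists>c. steiner_chain P Q k c"
  shows "\<forall>m\<in>{1..k - 1}. \<exists>I :: real. \<forall>c. steiner_chain P Q k c \<longrightarrow>
           (\<Sum>j<k. curvature (c j) ^ m) = I"
proof
  fix m assume "m \<in> {1..k - 1}"
  then have "m < k"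
    by auto
  show "\<exists>I. \<forall>c. steiner_chain P Q k c \<longrightarrow> (\<Sum>j<k. curvature (c j) ^ m) = I"
  proof (cases "center P = center Q")
    case True
    have "(\<Sum>j<k. curvature (c j) ^ m) = k * (2 / (radius Q - radius P)) ^ m"
      if "steiner_chain P Q k c" for c
    proof -
      have "curvature (c j) = 2 / (radius Q - radius P)" if "j < k" for j
      proof -
        have "inscribed_in_annulus P Q (c j)"
          using \<open>steiner_chain P Q k c\<close> that by (simp add: steiner_chain_def)
        from inscribed_norm[OF this] show ?thesis
          using True by (simp add: curvature_def field_simps)
      qed
      then show ?thesis
        by simp
    qed
    then show ?thesis
      by blast
  next
    case False
    define d where "d = dist (center P) (center Q)"
    define h where "h = ((radius Q)\<^sup>2 - (radius P)\<^sup>2 - d\<^sup>2) / (2 * d)"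
    define s where "s = (radius P + radius Q) / d"
    \<comment> \<open>The conic \<open>v\<^sup>2 = (1 + r b)\<^sup>2 - (s - h b)\<^sup>2\<close>, where \<open>r\<close> is the radius of \<open>P\<close> and
      \<open>s - h b\<close> is the axial coordinate.\<close>
    define \<alpha> where "\<alpha> = (radius P)\<^sup>2 - h\<^sup>2"
    define \<beta> where "\<beta> = radius P + s * h"
    define \<gamma> where "\<gamma> = 1 - s\<^sup>2"
    have "d > 0" and "radius P > 0"
      using False assms(2) by (simp_all add: d_def nested_def is_circle_def)
    have "(d + radius P)\<^sup>2 < (radius Q)\<^sup>2"
      using nested_dist_centers[OF assms(2)] \<open>d > 0\<close> \<open>radius P > 0\<close>
      by (intro power_strict_mono) (auto simp: d_def)
    then have "radius P < h"
      using \<open>d > 0\<close> by (simp add: h_def field_simps power2_eq_square)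
    then have "\<alpha> < 0"
      using \<open>radius P > 0\<close> by (simp add: \<alpha>_def power_strict_mono)
    then obtain I where I: "\<And>b v :: nat \<Rightarrow> real.
        inj_on (\<lambda>j. (b j, v j)) {..<k} \<Longrightarrow>
        \<forall>j<k. (v j)\<^sup>2 = \<alpha> * (b j)\<^sup>2 + 2 * \<beta> * b j + \<gamma> \<Longrightarrow>
        \<forall>j<k. \<alpha> * b j * b (Suc j mod k) + \<beta> * (b j + b (Suc j mod k)) + \<gamma>
                 - v j * v (Suc j mod k) = 2 \<Longrightarrow>
        (\<Sum>j<k. b j ^ m) = I"
      using power_sum_of_conic_chain_constant[OF assms(1) \<open>m < k\<close>, of \<alpha> 2 \<beta> \<gamma>] by auto
    have "(\<Sum>j<k. curvature (c j) ^ m) = I" if chain: "steiner_chain P Q k c" for c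
    proof (rule I[where v = "\<lambda>j. transversal P Q (c j)"]; (intro allI impI)?)
      have ins: "inscribed_in_annulus P Q (c j)" if "j < k" for j
        using chain that by (simp add: steiner_chain_def)
      have axial: "axial P Q (c j) = s - h * curvature (c j)" if "j < k" for j
        using axial_affine_in_curvature[OF ins[OF that] False] by (simp add: s_def h_def d_def)
      show "inj_on (\<lambda>j. (curvature (c j), transversal P Q (c j))) {..<k}"
        using chain inscribed_eqI[OF ins ins False]
        by (auto simp: inj_on_def steiner_chain_def)
      fix j assume "j < k"
      show "(transversal P Q (c j))\<^sup>2
          = \<alpha> * (curvature (c j))\<^sup>2 + 2 * \<beta> * curvature (c j) + \<gamma>"
        using inscribed_quadric[OF ins[OF \<open>j < k\<close>] False]
        unfolding axial[OF \<open>j < k\<close>]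
        by (simp add: \<alpha>_def \<beta>_def \<gamma>_def power2_eq_square algebra_simps)
      define i where "i = Suc j mod k"
      have "i < k"
        using \<open>j < k\<close> by (simp add: i_def)
      have "externally_tangent (c j) (c i)"
        using chain \<open>j < k\<close> by (simp add: steiner_chain_def i_def)
      from tangent_quadric_product[OF ins[OF \<open>j < k\<close>] ins[OF \<open>i < k\<close>] this False]
      have "\<alpha> * curvature (c j) * curvature (c i) + \<beta> * (curvature (c j) + curvature (c i)) + \<gamma>
          - transversal P Q (c j) * transversal P Q (c i) = 2"
        unfolding axial[OF \<open>j < k\<close>] axial[OF \<open>i < k\<close>]
        by (simp add: \<alpha>_def \<beta>_def \<gamma>_def power2_eq_square algebra_simps)
      then show "\<alpha> * curvature (c j) * curvature (c (Suc j mod k))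
          + \<beta> * (curvature (c j) + curvature (c (Suc j mod k))) + \<gamma>
          - transversal P Q (c j) * transversal P Q (c (Suc j mod k)) = 2"
        unfolding i_def .
    qed
    then show ?thesis
      by blast
  qed
qed

end
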